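(* Let $\Lambda$ be an alphabet and $M\subseteq\Lambda^*\setminus\{\varepsilon\}$ a set of words such that (a) for all nonempty words $\underline{u},\underline{v}$, if $\underline{u}\underline{v}\in M$ and $\underline{v}\in M$ then $\underline{u}\in M$, and (b) if $v_1\cdots v_n\in M$ then $v_1\cdots v_m\in M$ for all $1\le m\le n$. In the truncation game induced by $M$ on $\Lambda^*$, a word $\underline{v}\in\Lambda^*\setminus\{\varepsilon\}$ is a kernel position if and only if it can be obtained as a concatenation of one or several elementary kernel positions. Such a decomposition, if it exists, is unique.
   Context: $\Lambda^*$ is the free monoid of finite words over $\Lambda$, with empty word $\varepsilon$. The truncation game induced by $M$ has as positions all words of $\Lambda^*$; a valid move replaces $v_1\cdots v_n$ by $v_1\cdots v_i$ ($0\le i<n$) whenever $v_{i+1}\cdots v_n\in M$. Players alternate; a player unable to move loses. A kernel position is a position of Grundy number zero (equivalently, every valid move from it leads to a non-kernel position). A nonempty word $v_1\cdots v_n$ is an elementary kernel position if $v_1\cdots v_n\notin M$ but $v_1\cdots v_m\in M$ for all $1\le m<n$. *)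

theory Defs
  imports Main
begin

text \<open>
  Words over an alphabet \<open>\<Lambda>\<close> (an arbitrary set of letters) are the elements of \<open>lists \<Lambda>\<close>.
\<close>

definition truncation_move :: "'a list set \<Rightarrow> 'a list \<Rightarrow> 'a list \<Rightarrow> bool" where
  "truncation_move M v w \<longleftrightarrow> (\<exists>i<length v. w = take i v \<and> drop i v \<in> M)"

definition mex :: "nat set \<Rightarrow> nat" where
  "mex S = (LEAST k. k \<notin> S)"

function grundy :: "'a list set \<Rightarrow> 'a list \<Rightarrow> nat" where
  "grundy M v = mex (grundy M ` {w. truncation_move M v w})"
  by auto
termination
  by (relation "measure (\<lambda>(M, v). length v)") (auto simp: truncation_move_def)

declare grundy.simps [simp del]

definition kernel_position :: "'a set \<Rightarrow> 'a list set \<Rightarrow> 'a list \<Rightarrow> bool" where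
  "kernel_position \<Lambda> M v \<longleftrightarrow> v \<in> lists \<Lambda> \<and> grundy M v = 0"

definition elementary_kernel_position :: "'a set \<Rightarrow> 'a list set \<Rightarrow> 'a list \<Rightarrow> bool" where
  "elementary_kernel_position \<Lambda> M v \<longleftrightarrow>
     v \<in> lists \<Lambda> \<and> v \<noteq> [] \<and> v \<notin> M \<and> (\<forall>m. 1 \<le> m \<and> m < length v \<longrightarrow> take m v \<in> M)"

definition elementary_decomposition ::
    "'a set \<Rightarrow> 'a list set \<Rightarrow> 'a list list \<Rightarrow> 'a list \<Rightarrow> bool" where
  "elementary_decomposition \<Lambda> M ws v \<longleftrightarrow>
     ws \<noteq> [] \<and> (\<forall>w\<in>set ws. elementary_kernel_position \<Lambda> M w) \<and> concat ws = v"

lemma finite_truncation_moves: "finite {w. truncation_move M v w}"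
proof -
  have "{w. truncation_move M v w} \<subseteq> (\<lambda>i. take i v) ` {..<length v}"
    by (auto simp: truncation_move_def)
  then show ?thesis
    by (rule finite_subset) simp
qed

lemma mex_eq_0_iff:
  assumes "finite S"
  shows "mex S = 0 \<longleftrightarrow> 0 \<notin> S"
proof
  assume "mex S = 0"
  moreover have "\<exists>k. k \<notin> S"
    using assms infinite_UNIV_nat by (metis UNIV_eq_I)
  then have "mex S \<notin> S"
    unfolding mex_def by (rule LeastI_ex)
  ultimately show "0 \<notin> S" by simp
qed (simp add: mex_def)

lemma grundy_eq_0_iff:
  "grundy M v = 0 \<longleftrightarrow> (\<forall>w. truncation_move M v w \<longrightarrow> grundy M w \<noteq> 0)"
  by (subst grundy.simps, subst mex_eq_0_iff) (auto simp: finite_truncation_moves image_iff)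

end

theory Submission
  imports Defs
begin

text \<open>
  Repeatedly splitting off the shortest nonempty prefix outside \<open>M\<close>, which is elementary, writes
  any word as \<open>concat ws @ x\<close> with elementary factors \<open>ws\<close> and \<open>x = []\<close> or \<open>x \<in> M\<close>. By prefix
  closure of \<open>M\<close>, no move can start at the beginning of an elementary factor, and a move that starts
  inside one leaves a remainder in \<open>M\<close>, which the opponent removes; so a concatenation of elementary
  words is a kernel position, while \<open>concat ws @ x\<close> with \<open>x \<in> M\<close> is not. Elementary words form a
  prefix code, hence the uniqueness.
\<close>

text \<open>Deleting \<open>x\<close> is a move to the kernel position \<open>u\<close>. This serves
  both as the winning reply in \<open>grundy_concat_elementary\<close> and to exclude a remainder in
  \<open>M\<close> in the theorem.\<close>

lemma grundy_append_neq_0: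
  assumes "grundy M u = 0" and "x \<in> M" and "x \<noteq> []"
  shows "grundy M (u @ x) \<noteq> 0"
proof -
  have "truncation_move M (u @ x) u"
    unfolding truncation_move_def using assms(2,3) by (intro exI[of _ "length u"]) simp
  with assms(1) show ?thesis
    by (subst grundy_eq_0_iff) blast
qed

lemma grundy_concat_elementary:
  assumes prefix: "\<And>v m. \<lbrakk>v \<in> M; 1 \<le> m; m \<le> length v\<rbrakk> \<Longrightarrow> take m v \<in> M"
    and "\<forall>w\<in>set ws. elementary_kernel_position \<Lambda> M w"
  shows "grundy M (concat ws) = 0"
  using assms(2)
proof (induction ws rule: rev_induct)
  \<comment> \<open>The empty word admits no move at all.\<close>
  case Nil
  show ?case by (subst grundy_eq_0_iff) (simp add: truncation_move_def)
next
  case (snoc w ws)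
  let ?u = "concat ws"
  have IH: "grundy M ?u = 0" and w: "elementary_kernel_position \<Lambda> M w"
    using snoc by auto
  have "grundy M (take i (?u @ w)) \<noteq> 0"
    if i: "i < length (?u @ w)" and M: "drop i (?u @ w) \<in> M" for i
  proof -
    consider "i < length ?u" | "i = length ?u" | "length ?u < i" by linarith
    then show ?thesis
    proof cases
      case 1
      \<comment> \<open>The removed suffix is \<open>drop i ?u @ w\<close>. Its nonempty prefix
        \<open>drop i ?u\<close> is in \<open>M\<close> too, so the same target is already reachable
        from the kernel position \<open>?u\<close>.\<close>
      have "drop i ?u \<in> M"
        using prefix[OF M, of "length ?u - i"] 1 by simp
      then have "truncation_move M ?u (take i ?u)"
        using 1 by (auto simp: truncation_move_def)
      with IH 1 show ?thesis
        by (simp add: grundy_eq_0_iff[of M ?u])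
    next
      case 2
      \<comment> \<open>The removed suffix would be \<open>w\<close> itself, which lies outside
        \<open>M\<close>.\<close>
      with M w show ?thesis by (simp add: elementary_kernel_position_def)
    next
      case 3
      then have "1 \<le> i - length ?u" "i - length ?u < length w"
        using i by auto
      \<comment> \<open>After the move, \<open>?u\<close> is followed by a proper nonempty prefix of
        \<open>w\<close>, which can be deleted next.\<close>
      with w have "take (i - length ?u) w \<in> M"
        by (simp add: elementary_kernel_position_def)
      moreover have "take (i - length ?u) w \<noteq> []"
        using \<open>1 \<le> i - length ?u\<close> \<open>i - length ?u < length w\<close> by auto
      ultimately show ?thesis
        using grundy_append_neq_0[OF IH] 3 by simp
    qed
  qed
  then have "grundy M (?u @ w) = 0"
    by (subst grundy_eq_0_iff) (auto simp: truncation_move_def)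
  then show ?case by simp
qed

text \<open>Take the shortest nonempty prefix outside \<open>M\<close>. It exists because
  \<open>v\<close> itself is a candidate, and minimality puts its own proper nonempty prefixes in
  \<open>M\<close>.\<close>

lemma elementary_prefix_exists:
  assumes "v \<in> lists \<Lambda>" and "v \<noteq> []" and "v \<notin> M"
  obtains w v' where "elementary_kernel_position \<Lambda> M w" and "v = w @ v'"
proof -
  define n where "n = (LEAST m. 1 \<le> m \<and> take m v \<notin> M)"
  have ex: "1 \<le> length v \<and> take (length v) v \<notin> M"
    using assms by (simp add: Suc_le_eq)
  have n: "1 \<le> n" "take n v \<notin> M"
    unfolding n_def using LeastI[of "\<lambda>m. 1 \<le> m \<and> take m v \<notin> M", OF ex] by auto
  have min: "take m v \<in> M" if "1 \<le> m" "m < n" for m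
    using not_less_Least[of m "\<lambda>m. 1 \<le> m \<and> take m v \<notin> M"] that unfolding n_def by blast
  have "elementary_kernel_position \<Lambda> M (take n v)"
    unfolding elementary_kernel_position_def using assms n min
    by (auto dest: in_set_takeD)
  then show thesis
    by (rule that[of _ "drop n v"]) simp
qed

lemma elementary_factorization_with_remainder:
  assumes "v \<in> lists \<Lambda>"
  shows "\<exists>ws x. (\<forall>w\<in>set ws. elementary_kernel_position \<Lambda> M w) \<and> (x = [] \<or> x \<in> M)
    \<and> v = concat ws @ x"
  using assms
proof (induction v rule: length_induct)
  case (1 v)
  show ?case
  proof (cases "v = [] \<or> v \<in> M")
    case True
    then show ?thesis by (intro exI[of _ "[]"] exI[of _ v]) auto
  next
    case False
    then have "v \<noteq> []" "v \<notin> M" by auto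
    with 1(2) obtain w v' where w: "elementary_kernel_position \<Lambda> M w" and v: "v = w @ v'"
      by (rule elementary_prefix_exists)
    \<comment> \<open>The length drops because the elementary factor \<open>w\<close> is
      nonempty.\<close>
    have "length v' < length v" "v' \<in> lists \<Lambda>"
      using w v 1(2) by (auto simp: elementary_kernel_position_def)
    then obtain ws x where "\<forall>w\<in>set ws. elementary_kernel_position \<Lambda> M w" "x = [] \<or> x \<in> M"
      "v' = concat ws @ x"
      using 1(1) by blast
    with w v show ?thesis by (intro exI[of _ "w # ws"] exI[of _ x]) auto
  qed
qed

text \<open>If one word were a proper prefix of the other, it would lie in \<open>M\<close> as a
  proper nonempty prefix of an elementary word, and outside \<open>M\<close> by being
  elementary.\<close>

lemma elementary_prefix_code:
  assumes "elementary_kernel_position \<Lambda> M w" and "elementary_kernel_position \<Lambda> M w'"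
    and "w @ x = w' @ x'"
  shows "w = w'"
proof -
  have *: "\<not> length a < length b"
    if "elementary_kernel_position \<Lambda> M a" "elementary_kernel_position \<Lambda> M b" "a @ y = b @ z"
    for a b y z
  proof
    assume less: "length a < length b"
    then have "take (length a) b = a"
      using arg_cong[OF that(3), of "take (length a)"] by simp
    with less that(1,2) show False
      unfolding elementary_kernel_position_def by (metis One_nat_def Suc_leI length_greater_0_conv)
  qed
  have "length w = length w'"
    using *[OF assms] *[OF assms(2,1) assms(3)[symmetric]] by simp
  with assms(3) show ?thesis by simp
qed

lemma elementary_concat_inject:
  assumes "\<forall>w\<in>set ws. elementary_kernel_position \<Lambda> M w"
    and "\<forall>w\<in>set ws'. elementary_kernel_position \<Lambda> M w"
    and "concat ws = concat ws'"
  shows "ws = ws'"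
  using assms
proof (induction ws arbitrary: ws')
  case Nil
  then show ?case
    \<comment> \<open>Elementary words are nonempty, so only the empty list of factors has an empty
      concatenation.\<close>
    by (cases ws') (auto simp: elementary_kernel_position_def)
next
  case (Cons w ws)
  from Cons.prems obtain w' ws'' where ws': "ws' = w' # ws''"
    by (cases ws') (auto simp: elementary_kernel_position_def)
  with Cons.prems have "w = w'"
    by (intro elementary_prefix_code[of \<Lambda> M w w' "concat ws" "concat ws''"]) auto
  moreover have "ws = ws''"
    using Cons.prems ws' \<open>w = w'\<close> by (intro Cons.IH) auto
  ultimately show ?case
    using ws' by simp
qed

theorem theorem2p9:
  fixes \<Lambda> :: "'a set" and M :: "'a list set"
  assumes "M \<subseteq> lists \<Lambda> - {[]}"
    and "\<And>u v. \<lbrakk>u \<in> lists \<Lambda>; v \<in> lists \<Lambda>; u \<noteq> []; v \<noteq> []; u @ v \<in> M; v \<in> M\<rbrakk> \<Longrightarrow> u \<in> M"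
    and "\<And>v m. \<lbrakk>v \<in> M; 1 \<le> m; m \<le> length v\<rbrakk> \<Longrightarrow> take m v \<in> M"
  shows "\<forall>v \<in> lists \<Lambda> - {[]}.
    (kernel_position \<Lambda> M v \<longleftrightarrow> (\<exists>ws. elementary_decomposition \<Lambda> M ws v)) \<and>
    (\<forall>ws ws'. elementary_decomposition \<Lambda> M ws v \<and> elementary_decomposition \<Lambda> M ws' v \<longrightarrow> ws = ws')"
proof (intro ballI conjI iffI)
  fix v assume v: "v \<in> lists \<Lambda> - {[]}" and "kernel_position \<Lambda> M v"
  then have g: "grundy M v = 0" by (simp add: kernel_position_def)
  obtain ws x where ws: "\<forall>w\<in>set ws. elementary_kernel_position \<Lambda> M w"
    and x: "x = [] \<or> x \<in> M" and eq: "v = concat ws @ x"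
    using elementary_factorization_with_remainder[of v \<Lambda> M] v by auto
  have "grundy M (concat ws) = 0"
    using assms(3) ws by (rule grundy_concat_elementary)
  \<comment> \<open>Otherwise \<open>x\<close> is in \<open>M\<close>, and deleting it would lead
    from the kernel position \<open>v\<close> to the kernel position
    \<open>concat ws\<close>.\<close>
  then have "x = []"
    using grundy_append_neq_0[of M "concat ws" x] g x eq by auto
  \<comment> \<open>Since \<open>v\<close> is nonempty, there is at least one factor.\<close>
  with ws eq v show "\<exists>ws. elementary_decomposition \<Lambda> M ws v"
    by (intro exI[of _ ws]) (auto simp: elementary_decomposition_def)
next
  fix v assume v: "v \<in> lists \<Lambda> - {[]}" and "\<exists>ws. elementary_decomposition \<Lambda> M ws v"
  then obtain ws where ws: "\<forall>w\<in>set ws. elementary_kernel_position \<Lambda> M w" and "concat ws = v"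
    by (auto simp: elementary_decomposition_def)
  have "grundy M (concat ws) = 0"
    using assms(3) ws by (rule grundy_concat_elementary)
  with v \<open>concat ws = v\<close> show "kernel_position \<Lambda> M v"
    by (simp add: kernel_position_def)
next
  fix v
  show "\<forall>ws ws'. elementary_decomposition \<Lambda> M ws v \<and> elementary_decomposition \<Lambda> M ws' v \<longrightarrow> ws = ws'"
    by (auto simp: elementary_decomposition_def intro: elementary_concat_inject[of _ \<Lambda> M])
qed

end
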